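(* Let a well-founded LAF instance be given, together with a boolean realisability algebra for it (i.e. one whose orthogonality relation $\perp$ is empty) such that typing correlation holds (for every typing context $\Gamma$, typing decomposition $\Delta$, $\rho\in[\![\Gamma]\!]$ and $\mathfrak D\in[\![\Delta]\!]$, one has $\rho\cdot\mathfrak D\in[\![\Gamma\cdot\Delta]\!]$) and such that there is an empty semantic context $\rho_\emptyset$. Then there is no empty typing context $\Gamma_\emptyset$ and command $c$ such that $\Gamma_\emptyset\vdash c$.
   Context: Decompositions. For sets $\mathcal A,\mathcal B$, $D[\mathcal A,\mathcal B]$ is the free algebra given by $\Delta::= a\mid\mathsf{neg}(b)\mid\bullet\mid\Delta_1,\Delta_2$ ($a\in\mathcal A$, $b\in\mathcal B$). $\mathsf{DS}:=D[\mathbf 1,\mathbf 1]$; $|\Delta|$ is the projection of $\Delta$ to $\mathsf{DS}$. An $(\mathcal A,\mathcal B)$-context algebra is a set $C$ with partial maps $\Gamma(x^+)\in\mathcal A$ for $x^+\in\mathcal X^+$, $\Gamma(x^-)\in\mathcal B$ for $x^-\in\mathcal X^-$ (fixed label sets) and a total extension $\Gamma\cdot\Delta\in C$ for $\Delta\in D[\mathcal A,\mathcal B]$. $\Gamma$ is empty if both lookup maps are nowhere defined on it. LAF instance: label sets $\mathcal X^\pm$; sets $\mathcal A$ (atoms), $\mathcal M$ (molecules); an $(\mathcal A,\mathcal M)$-context algebra $\mathcal T$ of typing contexts; patterns $\mathsf{Pat}$ with $p\mapsto p^*\in\mathsf{DS}$; a decomposition relation $\Delta\Vdash p:M$ ($\Delta\in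 D[\mathcal A,\mathcal M]$) with $|\Delta|=p^*$ whenever $\Delta\Vdash p:M$. Terms: $t^+::=p\,d$; $d::=x^+\mid\mathsf{abs}(f)\mid\bullet\mid d_1,d_2$; commands $c::=\langle x^-\mid t^+\rangle\mid\langle f\mid t^+\rangle$, $f$ a partial function from patterns to commands. Typing rules: $\Gamma\vdash[p\,d:M]$ if $\Delta\Vdash p:M$ and $\Gamma\vdash d:\Delta$; $\Gamma\vdash\bullet:\bullet$; $\Gamma\vdash(d_1,d_2):(\Delta_1,\Delta_2)$ if $\Gamma\vdash d_i:\Delta_i$; $\Gamma\vdash x^+:a$ if $\Gamma(x^+)=a$; $\Gamma\vdash\mathsf{abs}(f):\mathsf{neg}(M)$ if for all $p,\Delta$ with $\Delta\Vdash p:M$, $\Gamma\cdot\Delta\vdash f(p)$, and $\mathrm{dom}(f)$ is exactly the set of patterns that decompose $M$; $\Gamma\vdash\langle x^-\mid t^+\rangle$ if $\Gamma\vdash[t^+:\Gamma(x^-)]$; $\Gamma\vdash\langle f\mid t^+\rangle$ if $\Gamma\vdash\mathsf{abs}(f):\mathsf{neg}(M)$ and $\Gamma\vdash[t^+:M]$ for some $M$. Well-founded: the transitive closure of $M'\prec M$ (there are $\Delta,p$ with $\Delta\Vdash p:M$ and $\mathsf{neg}(M')$ a leaf of $\Delta$) is well-founded. Realisability algebra: sets $\mathbb L,\mathbb P,\mathbb N$; $\perp\subseteq\mathbb N\times\mathbb P$; an $(\mathbb L,\mathbb N)$-context algebra $\mathcal S$ of semantic contexts; maps $\mathsf{sp}_p:D[\mathbb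 L,\mathbb N]\to\mathbb P$ for $p\in\mathsf{Pat}$; a partial map $(f,\rho)\mapsto[\![f]\!]_\rho\in\mathbb N$; sets $[\![a]\!]\subseteq\mathbb L$ for atoms $a$. Interpretation of types (by well-founded induction): $[\![M]\!]^+=\{\mathsf{sp}_p(\mathfrak D)\mid\Delta\Vdash p:M,\ \mathfrak D\in[\![\Delta]\!]\}$; $[\![M]\!]^-=\{\mathfrak n\mid\forall\mathfrak p\in[\![M]\!]^+,\ \mathfrak n\perp\mathfrak p\}$; $[\![\bullet]\!]=\{\bullet\}$; $[\![\Delta_1,\Delta_2]\!]=\{\mathfrak D_1,\mathfrak D_2\mid\mathfrak D_i\in[\![\Delta_i]\!]\}$; $[\![a]\!]$ given; $[\![\mathsf{neg}(M)]\!]=\{\mathsf{neg}(\mathfrak n)\mid\mathfrak n\in[\![M]\!]^-\}$; $[\![\Gamma]\!]=\{\rho\in\mathcal S\mid\rho(x^+)\in[\![\Gamma(x^+)]\!]$ for all $x^+$ where $\rho(x^+)$ is defined, $\rho(x^-)\in[\![\Gamma(x^-)]\!]^-$ for all $x^-$ where $\rho(x^-)$ is defined$\}$.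
   Formalization: The claim fails for [[Γ]] as written (an empty ρ then lies in every [[Γ]]); the formal version also requires ρ∈[[Γ]] to be defined at every label where Γ is defined, and takes the set N of negative denotations to be nonempty, since the claim can fail for empty N. *)

theory Defs
  imports Main
begin

text \<open>
  The sets making up a LAF instance and a realisability algebra (labels, atoms, molecules,
  patterns, contexts, denotations) are rendered as types; partial maps are option-valued.
\<close>

datatype (atoms: 'a, negs: 'b) decomp =
    Atom 'a
  | Neg 'b
  | Unit
  | Join "('a, 'b) decomp" "('a, 'b) decomp"

type_synonym dshape = "(unit, unit) decomp"

definition shape :: "('a, 'b) decomp \<Rightarrow> dshape" where
  "shape = map_decomp (\<lambda>_. ()) (\<lambda>_. ())"

record ('xp, 'xn, 'a, 'b, 'c) context_algebra =
  lookup_pos :: "'c \<Rightarrow> 'xp \<rightharpoonup> 'a"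
  lookup_neg :: "'c \<Rightarrow> 'xn \<rightharpoonup> 'b"
  extend_ctx :: "'c \<Rightarrow> ('a, 'b) decomp \<Rightarrow> 'c"

definition empty_ctx :: "('xp, 'xn, 'a, 'b, 'c) context_algebra \<Rightarrow> 'c \<Rightarrow> bool" where
  "empty_ctx C \<Gamma> \<longleftrightarrow>
     (\<forall>x. lookup_pos C \<Gamma> x = None) \<and> (\<forall>x. lookup_neg C \<Gamma> x = None)"

record ('xp, 'xn, 'a, 'm, 't, 'p) laf =
  typing_contexts :: "('xp, 'xn, 'a, 'm, 't) context_algebra"
  pattern_shape :: "'p \<Rightarrow> dshape"
  decomposes :: "('a, 'm) decomp \<Rightarrow> 'p \<Rightarrow> 'm \<Rightarrow> bool"

definition laf_instance :: "('xp, 'xn, 'a, 'm, 't, 'p) laf \<Rightarrow> bool" where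
  "laf_instance L \<longleftrightarrow>
     (\<forall>\<Delta> p M. decomposes L \<Delta> p M \<longrightarrow> shape \<Delta> = pattern_shape L p)"

definition prec :: "('xp, 'xn, 'a, 'm, 't, 'p) laf \<Rightarrow> ('m \<times> 'm) set" where
  "prec L = {(M', M). \<exists>\<Delta> p. decomposes L \<Delta> p M \<and> M' \<in> negs \<Delta>}"

definition well_founded_laf :: "('xp, 'xn, 'a, 'm, 't, 'p) laf \<Rightarrow> bool" where
  "well_founded_laf L \<longleftrightarrow> wf ((prec L)\<^sup>+)"

datatype ('xp, 'xn, 'p) pos_term =
    App 'p "('xp, 'xn, 'p) decomp_term"
and ('xp, 'xn, 'p) decomp_term =
    Lab 'xp
  | Abs "'p \<rightharpoonup> ('xp, 'xn, 'p) command"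
  | UnitT
  | JoinT "('xp, 'xn, 'p) decomp_term" "('xp, 'xn, 'p) decomp_term"
and ('xp, 'xn, 'p) command =
    Select 'xn "('xp, 'xn, 'p) pos_term"
  | Cut "'p \<rightharpoonup> ('xp, 'xn, 'p) command" "('xp, 'xn, 'p) pos_term"

inductive
  typed_pos :: "('xp, 'xn, 'a, 'm, 't, 'p) laf \<Rightarrow> 't \<Rightarrow> ('xp, 'xn, 'p) pos_term \<Rightarrow> 'm \<Rightarrow> bool" and
  typed_decomp :: "('xp, 'xn, 'a, 'm, 't, 'p) laf \<Rightarrow> 't \<Rightarrow> ('xp, 'xn, 'p) decomp_term
     \<Rightarrow> ('a, 'm) decomp \<Rightarrow> bool" and
  typed_command :: "('xp, 'xn, 'a, 'm, 't, 'p) laf \<Rightarrow> 't \<Rightarrow> ('xp, 'xn, 'p) command \<Rightarrow> bool"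
  for L :: "('xp, 'xn, 'a, 'm, 't, 'p) laf"
where
  typed_App:
    "decomposes L \<Delta> p M \<Longrightarrow> typed_decomp L \<Gamma> d \<Delta> \<Longrightarrow> typed_pos L \<Gamma> (App p d) M"
| typed_UnitT:
    "typed_decomp L \<Gamma> UnitT Unit"
| typed_JoinT:
    "typed_decomp L \<Gamma> d1 \<Delta>1 \<Longrightarrow> typed_decomp L \<Gamma> d2 \<Delta>2
     \<Longrightarrow> typed_decomp L \<Gamma> (JoinT d1 d2) (Join \<Delta>1 \<Delta>2)"
| typed_Lab:
    "lookup_pos (typing_contexts L) \<Gamma> x = Some a \<Longrightarrow> typed_decomp L \<Gamma> (Lab x) (Atom a)"
| typed_Abs:
    "(\<And>p \<Delta>. decomposes L \<Delta> p M \<Longrightarrow>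
        \<exists>c. f p = Some c \<and> typed_command L (extend_ctx (typing_contexts L) \<Gamma> \<Delta>) c)
     \<Longrightarrow> dom f = {p. \<exists>\<Delta>. decomposes L \<Delta> p M}
     \<Longrightarrow> typed_decomp L \<Gamma> (Abs f) (Neg M)"
| typed_Select:
    "lookup_neg (typing_contexts L) \<Gamma> x = Some M \<Longrightarrow> typed_pos L \<Gamma> t M
     \<Longrightarrow> typed_command L \<Gamma> (Select x t)"
| typed_Cut:
    "typed_decomp L \<Gamma> (Abs f) (Neg M) \<Longrightarrow> typed_pos L \<Gamma> t M
     \<Longrightarrow> typed_command L \<Gamma> (Cut f t)"

record ('xp, 'xn, 'a, 'p, 'l, 'pd, 'n, 's) realisability_algebra =
  orth :: "'n \<Rightarrow> 'pd \<Rightarrow> bool"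
  semantic_contexts :: "('xp, 'xn, 'l, 'n, 's) context_algebra"
  sp :: "'p \<Rightarrow> ('l, 'n) decomp \<Rightarrow> 'pd"
  fun_sem :: "('p \<rightharpoonup> ('xp, 'xn, 'p) command) \<Rightarrow> 's \<rightharpoonup> 'n"
  atom_sem :: "'a \<Rightarrow> 'l set"

definition boolean_realisability ::
    "('xp, 'xn, 'a, 'p, 'l, 'pd, 'n, 's) realisability_algebra \<Rightarrow> bool" where
  "boolean_realisability R \<longleftrightarrow> (\<forall>n q. \<not> orth R n q)"

definition orthogonal ::
    "('xp, 'xn, 'a, 'p, 'l, 'pd, 'n, 's) realisability_algebra \<Rightarrow> 'pd set \<Rightarrow> 'n set" where
  "orthogonal R Q = {n. \<forall>q\<in>Q. orth R n q}"

primrec decomp_interp ::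
    "('a \<Rightarrow> 'l set) \<Rightarrow> ('m \<Rightarrow> 'n set) \<Rightarrow> ('a, 'm) decomp \<Rightarrow> ('l, 'n) decomp set" where
  "decomp_interp A N (Atom a) = {Atom l | l. l \<in> A a}"
| "decomp_interp A N (Neg M) = {Neg n | n. n \<in> N M}"
| "decomp_interp A N Unit = {Unit}"
| "decomp_interp A N (Join \<Delta>1 \<Delta>2) =
     {Join D1 D2 | D1 D2. D1 \<in> decomp_interp A N \<Delta>1 \<and> D2 \<in> decomp_interp A N \<Delta>2}"

text \<open>
  The interpretation of molecules is defined by well-founded recursion; it is meaningful for
  well-founded instances only, where \<open>pos_sem_unfold\<close> below is its characteristic equation.
\<close>

definition pos_sem :: "('xp, 'xn, 'a, 'm, 't, 'p) laf
    \<Rightarrow> ('xp, 'xn, 'a, 'p, 'l, 'pd, 'n, 's) realisability_algebra \<Rightarrow> 'm \<Rightarrow> 'pd set" where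
  "pos_sem L R = wfrec ((prec L)\<^sup>+)
     (\<lambda>pos M. {sp R p D | p D \<Delta>. decomposes L \<Delta> p M \<and>
        D \<in> decomp_interp (atom_sem R) (\<lambda>M'. orthogonal R (pos M')) \<Delta>})"

definition neg_sem :: "('xp, 'xn, 'a, 'm, 't, 'p) laf
    \<Rightarrow> ('xp, 'xn, 'a, 'p, 'l, 'pd, 'n, 's) realisability_algebra \<Rightarrow> 'm \<Rightarrow> 'n set" where
  "neg_sem L R M = orthogonal R (pos_sem L R M)"

definition decomp_sem :: "('xp, 'xn, 'a, 'm, 't, 'p) laf
    \<Rightarrow> ('xp, 'xn, 'a, 'p, 'l, 'pd, 'n, 's) realisability_algebra
    \<Rightarrow> ('a, 'm) decomp \<Rightarrow> ('l, 'n) decomp set" where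
  "decomp_sem L R = decomp_interp (atom_sem R) (neg_sem L R)"

lemma decomp_interp_cong:
  "(\<And>M. M \<in> negs \<Delta> \<Longrightarrow> N M = N' M) \<Longrightarrow> decomp_interp A N \<Delta> = decomp_interp A N' \<Delta>"
  by (induction \<Delta>) auto

lemma pos_sem_unfold:
  assumes "well_founded_laf L"
  shows "pos_sem L R M = {sp R p D | p D \<Delta>. decomposes L \<Delta> p M \<and> D \<in> decomp_sem L R \<Delta>}"
proof -
  have eq: "decomp_interp (atom_sem R)
        (\<lambda>M'. orthogonal R (cut (pos_sem L R) ((prec L)\<^sup>+) M M')) \<Delta> = decomp_sem L R \<Delta>"
    if "decomposes L \<Delta> p M" for \<Delta> p
    unfolding decomp_sem_def
  proof (rule decomp_interp_cong)
    fix M' assume "M' \<in> negs \<Delta>"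
    with that have "(M', M) \<in> (prec L)\<^sup>+"
      by (auto simp: prec_def)
    then show "orthogonal R (cut (pos_sem L R) ((prec L)\<^sup>+) M M') = neg_sem L R M'"
      by (simp add: cut_apply neg_sem_def)
  qed
  have "wf ((prec L)\<^sup>+)"
    using assms by (simp add: well_founded_laf_def)
  from def_wfrec[OF pos_sem_def[THEN eq_reflection] this, of R M]
  show ?thesis
    using eq by blast
qed

text \<open>
  Typing contexts and semantic contexts correspond on a common domain. The last two conjuncts
  (every label declared in \<open>\<Gamma>\<close> is given a value by \<open>\<rho>\<close>) cannot be dropped: without
  them an empty semantic context would realise every typing context, typing correlation could
  hold vacuously, and consistency would fail.
\<close>

definition ctx_sem :: "('xp, 'xn, 'a, 'm, 't, 'p) laf
    \<Rightarrow> ('xp, 'xn, 'a, 'p, 'l, 'pd, 'n, 's) realisability_algebra \<Rightarrow> 't \<Rightarrow> 's set" where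
  "ctx_sem L R \<Gamma> = {\<rho>.
     (\<forall>x l. lookup_pos (semantic_contexts R) \<rho> x = Some l \<longrightarrow>
        (\<exists>a. lookup_pos (typing_contexts L) \<Gamma> x = Some a \<and> l \<in> atom_sem R a)) \<and>
     (\<forall>x n. lookup_neg (semantic_contexts R) \<rho> x = Some n \<longrightarrow>
        (\<exists>M. lookup_neg (typing_contexts L) \<Gamma> x = Some M \<and> n \<in> neg_sem L R M)) \<and>
     dom (lookup_pos (typing_contexts L) \<Gamma>) \<subseteq> dom (lookup_pos (semantic_contexts R) \<rho>) \<and>
     dom (lookup_neg (typing_contexts L) \<Gamma>) \<subseteq> dom (lookup_neg (semantic_contexts R) \<rho>)}"

definition typing_correlation :: "('xp, 'xn, 'a, 'm, 't, 'p) laf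
    \<Rightarrow> ('xp, 'xn, 'a, 'p, 'l, 'pd, 'n, 's) realisability_algebra \<Rightarrow> bool" where
  "typing_correlation L R \<longleftrightarrow>
     (\<forall>\<Gamma> \<Delta>. \<forall>\<rho> \<in> ctx_sem L R \<Gamma>. \<forall>D \<in> decomp_sem L R \<Delta>.
        extend_ctx (semantic_contexts R) \<rho> D \<in> ctx_sem L R (extend_ctx (typing_contexts L) \<Gamma> \<Delta>))"

end

theory Submission
  imports Defs
begin

text \<open>
  Orthogonality being empty, the negative interpretation of a molecule is inhabited exactly when
  its positive interpretation is empty. Hence a semantic interpretation of terms is not needed:
  induction on typing derivations shows that, as soon as a context has a realiser, every typed
  term has an inhabited type, whereas no command is typed. Typing correlation provides the
  realiser for the extended contexts under an abstraction.
\<close>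

lemma neg_sem_boolean:
  assumes "boolean_realisability R"
  shows "neg_sem L R M = (if pos_sem L R M = {} then UNIV else {})"
  using assms by (auto simp: neg_sem_def orthogonal_def boolean_realisability_def)

lemma ctx_sem_empty:
  assumes "empty_ctx (typing_contexts L) \<Gamma>" "empty_ctx (semantic_contexts R) \<rho>"
  shows "\<rho> \<in> ctx_sem L R \<Gamma>"
  using assms by (auto simp: ctx_sem_def empty_ctx_def)

lemma boolean_adequacy:
  assumes wf: "well_founded_laf L"
    and bool: "boolean_realisability R"
    and corr: "typing_correlation L R"
  shows typed_pos_sem_nonempty:
      "typed_pos L \<Gamma> t M \<Longrightarrow> ctx_sem L R \<Gamma> \<noteq> {} \<Longrightarrow> pos_sem L R M \<noteq> {}"
    and typed_decomp_sem_nonempty: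
      "typed_decomp L \<Gamma> d \<Delta> \<Longrightarrow> ctx_sem L R \<Gamma> \<noteq> {} \<Longrightarrow> decomp_sem L R \<Delta> \<noteq> {}"
    and typed_command_ctx_sem_empty:
      "typed_command L \<Gamma> c \<Longrightarrow> ctx_sem L R \<Gamma> = {}"
proof (induction rule: typed_pos_typed_decomp_typed_command.inducts)
  case (typed_App \<Delta> p M \<Gamma> d)
  then show ?case
    by (auto simp: pos_sem_unfold[OF wf])
next
  case (typed_UnitT \<Gamma>)
  show ?case
    by (simp add: decomp_sem_def)
next
  case (typed_JoinT \<Gamma> d1 \<Delta>1 d2 \<Delta>2)
  then show ?case
    by (auto simp: decomp_sem_def)
next
  case (typed_Lab \<Gamma> x a)
  then obtain \<rho> where \<rho>: "\<rho> \<in> ctx_sem L R \<Gamma>"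
    by blast
  with typed_Lab(1) obtain l where "lookup_pos (semantic_contexts R) \<rho> x = Some l"
    unfolding ctx_sem_def by blast
  with typed_Lab(1) \<rho> have "l \<in> atom_sem R a"
    unfolding ctx_sem_def by force
  then show ?case
    by (auto simp: decomp_sem_def)
next
  case (typed_Abs M f \<Gamma>)
  from typed_Abs(3) obtain \<rho> where \<rho>: "\<rho> \<in> ctx_sem L R \<Gamma>"
    by blast
  have "decomp_sem L R \<Delta> = {}" if "decomposes L \<Delta> p M" for \<Delta> p
  proof -
    have "ctx_sem L R (extend_ctx (typing_contexts L) \<Gamma> \<Delta>) = {}"
      using typed_Abs(1)[OF that] by blast
    with corr \<rho> show ?thesis
      unfolding typing_correlation_def by blast
  qed
  then have "pos_sem L R M = {}"
    by (auto simp: pos_sem_unfold[OF wf])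
  then show ?case
    by (auto simp: decomp_sem_def neg_sem_boolean[OF bool])
next
  case (typed_Select \<Gamma> x M t)
  show ?case
  proof (rule ccontr)
    assume ne: "ctx_sem L R \<Gamma> \<noteq> {}"
    then obtain \<rho> where \<rho>: "\<rho> \<in> ctx_sem L R \<Gamma>"
      by blast
    with typed_Select(1) obtain n where "lookup_neg (semantic_contexts R) \<rho> x = Some n"
      unfolding ctx_sem_def by blast
    with typed_Select(1) \<rho> have "n \<in> neg_sem L R M"
      unfolding ctx_sem_def by force
    with typed_Select(3)[OF ne] show False
      by (simp add: neg_sem_boolean[OF bool])
  qed
next
  case (typed_Cut \<Gamma> f M t)
  then show ?case
    by (cases "pos_sem L R M = {}") (auto simp: decomp_sem_def neg_sem_boolean[OF bool])
qed

theorem mainTheorem2: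
  fixes L :: "('xp, 'xn, 'a, 'm, 't, 'p) laf"
    and R :: "('xp, 'xn, 'a, 'p, 'l, 'pd, 'n, 's) realisability_algebra"
  assumes "laf_instance L"
    and "well_founded_laf L"
    and "boolean_realisability R"
    and "typing_correlation L R"
    and "\<exists>\<rho>. empty_ctx (semantic_contexts R) \<rho>"
  shows "\<not> (\<exists>\<Gamma> c. empty_ctx (typing_contexts L) \<Gamma> \<and> typed_command L \<Gamma> c)"
proof
  assume "\<exists>\<Gamma> c. empty_ctx (typing_contexts L) \<Gamma> \<and> typed_command L \<Gamma> c"
  then obtain \<Gamma> c where \<Gamma>: "empty_ctx (typing_contexts L) \<Gamma>" and c: "typed_command L \<Gamma> c"
    by blast
  from assms(5) obtain \<rho> where "empty_ctx (semantic_contexts R) \<rho>"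
    by blast
  with \<Gamma> have "\<rho> \<in> ctx_sem L R \<Gamma>"
    by (rule ctx_sem_empty)
  with typed_command_ctx_sem_empty[OF assms(2-4) c] show False
    by simp
qed

end
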